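(* Let $P$ be an atomic Puiseux monoid. If $P$ contains a stable atom, then $\rho_k(P)$ is infinite for all sufficiently large $k$; that is, there exists $K \in \mathbb{N}$ such that $\rho_k(P) = \infty$ for every integer $k \ge K$.
   Context: $\mathbb{N}$ denotes the set of positive integers and $\mathbb{N}_0 = \mathbb{N}\cup\{0\}$. A Puiseux monoid is an additive submonoid of $(\mathbb{Q},+)$ consisting of nonnegative rationals. For a rational $q>0$, $\mathsf{n}(q)$ and $\mathsf{d}(q)$ denote the unique relatively prime positive integers with $q = \mathsf{n}(q)/\mathsf{d}(q)$ (numerator and denominator). An element $a \in P\setminus\{0\}$ is an atom if $a = x+y$ with $x,y\in P$ implies $x=0$ or $y=0$; $\mathcal{A}(P)$ denotes the set of atoms of $P$. $P$ is atomic if it is generated as a monoid by $\mathcal{A}(P)$. An atom $a_0 \in \mathcal{A}(P)$ is stable if the set $\{a \in \mathcal{A}(P) : \mathsf{n}(a) = \mathsf{n}(a_0)\}$ is infinite. A factorization of $x \in P$ is a formal sum (up to permutation) $a_1+\dots+a_\ell$ of atoms of $P$ (repetitions allowed) whose value in $P$ is $x$; its length is $\ell$. $\mathsf{L}(x)$ is the set of all lengths of factorizations of $x$. For $n\in\mathbb{N}_0$, $\mathcal{U}_n(P)$ is the union of the sets $\mathsf{L}(x)$ over all $x \in P$ with $n \in \mathsf{L}(x)$, and $\rho_n(P) = \sup \mathcal{U}_n(P)$ (supremum taken in $\mathbb{N}_0\cup\{\infty\}$) is the $n$-th local elasticity of $P$. *)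

theory Defs
  imports Complex_Main "HOL-Library.Multiset" "HOL-Library.Extended_Nat"
begin

definition add_submonoid :: "'a::comm_monoid_add set \<Rightarrow> bool" where
  "add_submonoid S \<longleftrightarrow> 0 \<in> S \<and> (\<forall>x\<in>S. \<forall>y\<in>S. x + y \<in> S)"

definition puiseux_monoid :: "rat set \<Rightarrow> bool" where
  "puiseux_monoid P \<longleftrightarrow> add_submonoid P \<and> (\<forall>x\<in>P. 0 \<le> x)"

(* quotient_of q is the pair (n, d) of coprime integers with d > 0 and q = n / d. *)
definition numerator :: "rat \<Rightarrow> int" where
  "numerator q = fst (quotient_of q)"

definition atoms :: "'a::comm_monoid_add set \<Rightarrow> 'a set" where
  "atoms P = {a \<in> P. a \<noteq> 0 \<and> (\<forall>x\<in>P. \<forall>y\<in>P. a = x + y \<longrightarrow> x = 0 \<or> y = 0)}"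

definition atomic :: "'a::comm_monoid_add set \<Rightarrow> bool" where
  "atomic P \<longleftrightarrow> add_submonoid hull (atoms P) = P"

definition stable_atom :: "rat set \<Rightarrow> rat \<Rightarrow> bool" where
  "stable_atom P a0 \<longleftrightarrow>
     a0 \<in> atoms P \<and> infinite {a \<in> atoms P. numerator a = numerator a0}"

(* A formal sum of atoms up to permutation is a finite multiset of atoms. *)
definition factorizations :: "'a::comm_monoid_add set \<Rightarrow> 'a \<Rightarrow> 'a multiset set" where
  "factorizations P x = {F. set_mset F \<subseteq> atoms P \<and> \<Sum>\<^sub># F = x}"

definition lengths :: "'a::comm_monoid_add set \<Rightarrow> 'a \<Rightarrow> nat set" where
  "lengths P x = size ` factorizations P x"

definition length_union :: "nat \<Rightarrow> 'a::comm_monoid_add set \<Rightarrow> nat set" where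
  "length_union n P = (\<Union>x\<in>{x \<in> P. n \<in> lengths P x}. lengths P x)"

definition local_elasticity :: "nat \<Rightarrow> 'a::comm_monoid_add set \<Rightarrow> enat" where
  "local_elasticity n P = Sup (enat ` length_union n P)"

end

theory Submission
  imports Defs
begin

text \<open>
  Atoms sharing a numerator \<open>n\<close> have a common multiple that is independent of the atom: if
  \<open>a = n / d\<close>, then adding up \<open>d\<close> copies of \<open>a\<close> gives \<open>n\<close>. If \<open>a0 = n / d0\<close> is stable, infinitely
  many atoms have numerator \<open>n\<close>, so their denominators are unbounded, and the single element \<open>n\<close>
  has a factorization of length \<open>d0\<close> as well as arbitrarily long ones
  (\<open>stable_numerator_lengths_infinite\<close>). Padding all of them with the same \<open>k - d0\<close> copies of \<open>a0\<close>
  gives \<open>\<rho>\<^sub>k = \<infinity>\<close> for every \<open>k \<ge> d0\<close>; thus \<open>K\<close> may be taken to be the denominator of \<open>a0\<close>.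
\<close>

definition denominator :: "rat \<Rightarrow> nat" where
  "denominator q = nat (snd (quotient_of q))"

lemma denominator_pos: "denominator q > 0"
  by (simp add: denominator_def quotient_of_denom_pos')

lemma denominator_mult_self: "of_nat (denominator q) * q = of_int (numerator q)"
proof -
  obtain n d where q: "quotient_of q = (n, d)" by fastforce
  then have "d > 0" "q = of_int n / of_int d"
    using quotient_of_denom_pos quotient_of_div by auto
  then show ?thesis
    using q by (simp add: denominator_def numerator_def)
qed

lemma sum_mset_in_add_submonoid:
  assumes "add_submonoid S" and "set_mset F \<subseteq> S"
  shows "\<Sum>\<^sub># F \<in> S"
  using assms(2) by (induction F) (use assms(1) in \<open>auto simp: add_submonoid_def\<close>)

lemma sum_mset_replicate_mset_rat:
  "\<Sum>\<^sub># (replicate_mset n (q :: rat)) = of_nat n * q"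
  by (induction n) (auto simp: algebra_simps)

lemma lengths_add:
  assumes "m \<in> lengths P x" and "n \<in> lengths P y"
  shows "m + n \<in> lengths P (x + y)"
proof -
  obtain F G where "F \<in> factorizations P x" "m = size F" "G \<in> factorizations P y" "n = size G"
    using assms by (auto simp: lengths_def)
  then have "F + G \<in> factorizations P (x + y)" "m + n = size (F + G)"
    by (auto simp: factorizations_def)
  then show ?thesis
    unfolding lengths_def by blast
qed

lemma lengths_nonempty_imp_mem:
  assumes "add_submonoid P" and "n \<in> lengths P x"
  shows "x \<in> P"
proof -
  obtain F where "set_mset F \<subseteq> atoms P" "\<Sum>\<^sub># F = x"
    using assms(2) by (auto simp: lengths_def factorizations_def)
  moreover have "atoms P \<subseteq> P"
    by (auto simp: atoms_def)
  ultimately show ?thesis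
    using sum_mset_in_add_submonoid[OF assms(1), of F] by blast
qed

lemma multiple_of_atom_length:
  fixes a :: rat
  assumes "a \<in> atoms P"
  shows "n \<in> lengths P (of_nat n * a)"
proof -
  have "replicate_mset n a \<in> factorizations P (of_nat n * a)"
    using assms by (auto simp: factorizations_def sum_mset_replicate_mset_rat in_replicate_mset)
  then show ?thesis
    unfolding lengths_def by (metis imageI size_replicate_mset)
qed

lemma denominator_in_lengths_numerator:
  assumes "a \<in> atoms P"
  shows "denominator a \<in> lengths P (of_int (numerator a))"
  using multiple_of_atom_length[OF assms, of "denominator a"]
  by (simp add: denominator_mult_self)

text \<open>
  A rational is determined by its numerator and denominator, so infinitely many atoms with the
  numerator of \<open>a0\<close> have infinitely many denominators, each of which is a length of that numerator.
\<close>

lemma stable_numerator_lengths_infinite: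
  assumes "stable_atom P a0"
  shows "infinite (lengths P (of_int (numerator a0)))"
proof -
  let ?A = "{a \<in> atoms P. numerator a = numerator a0}"
  have "inj_on denominator ?A"
  proof (rule inj_onI)
    fix a b assume "a \<in> ?A" "b \<in> ?A" "denominator a = denominator b"
    then have "of_nat (denominator a) * a = of_nat (denominator a) * b"
      using denominator_mult_self[of a] denominator_mult_self[of b] by simp
    then show "a = b"
      using denominator_pos[of a] by simp
  qed
  then have "infinite (denominator ` ?A)"
    using assms by (simp add: stable_atom_def finite_image_iff)
  moreover have "denominator ` ?A \<subseteq> lengths P (of_int (numerator a0))"
    using denominator_in_lengths_numerator by fastforce
  ultimately show ?thesis
    using finite_subset by blast
qed

lemma local_elasticity_infinite:
  assumes "infinite (length_union k P)"
  shows "local_elasticity k P = \<infinity>"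
proof -
  have "infinite (enat ` length_union k P)"
    using assms by (simp add: finite_image_iff inj_on_def)
  then show ?thesis
    by (auto simp: local_elasticity_def Sup_enat_def)
qed

theorem proposition3p1:
  fixes P :: "rat set"
  assumes "puiseux_monoid P"
    and "atomic P"
    and "\<exists>a0. stable_atom P a0"
  shows "\<exists>K::nat. K \<ge> 1 \<and> (\<forall>k\<ge>K. local_elasticity k P = \<infinity>)"
proof -
  obtain a0 where stable: "stable_atom P a0"
    using assms(3) by blast
  then have atom: "a0 \<in> atoms P"
    by (simp add: stable_atom_def)
  have P: "add_submonoid P"
    using assms(1) by (simp add: puiseux_monoid_def)
  define N :: rat where "N = of_int (numerator a0)"
  have "local_elasticity k P = \<infinity>" if k: "k \<ge> denominator a0" for k
  proof -
    define r where "r = k - denominator a0"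
    define x where "x = N + of_nat r * a0"
    have padded: "l + r \<in> lengths P x" if "l \<in> lengths P N" for l
      using lengths_add[OF that multiple_of_atom_length[OF atom]] by (simp add: x_def)
    have "k \<in> lengths P x"
      using padded[of "denominator a0"] denominator_in_lengths_numerator[OF atom] k
      by (simp add: N_def r_def)
    then have "lengths P x \<subseteq> length_union k P"
      using lengths_nonempty_imp_mem[OF P] by (auto simp: length_union_def)
    then have "(\<lambda>l. l + r) ` lengths P N \<subseteq> length_union k P"
      using padded by blast
    moreover have "infinite ((\<lambda>l. l + r) ` lengths P N)"
      using stable_numerator_lengths_infinite[OF stable] by (simp add: N_def finite_image_iff)
    ultimately show ?thesis
      using local_elasticity_infinite finite_subset by blast
  qed
  then show ?thesis
    using denominator_pos[of a0] by (intro exI[of _ "denominator a0"]) auto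
qed

end
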